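(* Let $G$ be a graph with vertex set $\{1,\dots,n\}$, $n>3$, and maximum degree $\Delta$. Let $H$ be a fixed but arbitrary graph (possibly with self-loops) with $q$ vertices, and let $\mathcal{M}_{\mathrm{Gl}}$ and $\mathcal{M}_{\rightarrow}$ be the Glauber dynamics and the systematic scan, respectively, applied to $H$-colorings of $G$. Then $$\lambda(\mathcal{M}_{\mathrm{Gl}})\ \le\ 4\,q^{\Delta+1}\,\lambda(\mathcal{M}_{\rightarrow}).$$
   Context: $G$ and $H$ are finite undirected graphs. An $H$-coloring of $G$ is a graph homomorphism from $G$ to $H$, i.e. a map $\sigma:V(G)\to V(H)$ such that $\sigma_i\sigma_j$ is an edge of $H$ (possibly a loop) whenever $ij$ is an edge of $G$. The state space $\Omega$ is the set of $H$-colorings of $G$, and $\pi$ is the uniform distribution on $\Omega$, which is stationary for both chains. The procedure Metropolis($v$): choose a color $c\in V(H)$ uniformly at random and propose recoloring $v$ with $c$; the proposal is accepted if and only if every neighbor $w$ of $v$ in $G$ is colored with a neighbor (in $H$) of $c$; otherwise the coloring is unchanged. One step of $\mathcal{M}_{\mathrm{Gl}}$: choose a vertex $v$ of $G$ uniformly at random and do Metropolis($v$). One step of $\mathcal{M}_{\rightarrow}$: for $v=1,2,\dots,n$ in this order, do Metropolis($v$) (with independent color choices). For a Markov chain $\mathcal{M}$ with transition matrix $P$, stationary distribution $\pi$ and state space $\Omega$, the optimal Poincaré constant is $$\lambda(\mathcal{M})=\inf_{f:\Omega\to\mathbb{R}}\frac{\mathcal{E}_{\mathcal{M}}(f,f)}{\mathrm{var}_\pi(f)},$$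 the infimum over nonconstant $f$, where $\mathcal{E}_{\mathcal{M}}(f,f)=\frac12\sum_{x,y\in\Omega}\pi(x)P(x,y)(f(x)-f(y))^2$ and $\mathrm{var}_\pi(f)=\sum_{x\in\Omega}\pi(x)(f(x)-\mathbf{E}_\pi f)^2$. *)

theory Defs
  imports "HOL-Probability.Probability" "Graph_Theory.Pair_Digraph"
begin

text \<open>
  Undirected graphs are symmetric arc relations: \<open>pair_graph\<close> is a finite simple graph and
  \<open>pair_pseudo_graph\<close> a finite graph that may have loops. An undirected edge is present as both
  of its arcs, so the degree of a vertex of a simple graph is its \<open>out_degree\<close>.
\<close>

definition max_degree :: "'a pair_pre_digraph \<Rightarrow> nat" where
  "max_degree G = Max (out_degree (with_proj G) ` pverts G)"

text \<open>Colorings are extensional functions, so each map \<open>V(G) \<rightarrow> V(H)\<close> is represented once.\<close>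

definition colorings :: "'a pair_pre_digraph \<Rightarrow> 'c pair_pre_digraph \<Rightarrow> ('a \<Rightarrow> 'c) set" where
  "colorings G H =
     {\<sigma> \<in> pverts G \<rightarrow>\<^sub>E pverts H. \<forall>i j. (i, j) \<in> parcs G \<longrightarrow> (\<sigma> i, \<sigma> j) \<in> parcs H}"

definition metropolis ::
  "'a pair_pre_digraph \<Rightarrow> 'c pair_pre_digraph \<Rightarrow> 'a \<Rightarrow> ('a \<Rightarrow> 'c) \<Rightarrow> ('a \<Rightarrow> 'c) pmf" where
  "metropolis G H v \<sigma> =
     map_pmf
       (\<lambda>c. if \<forall>w. (v, w) \<in> parcs G \<longrightarrow> (c, \<sigma> w) \<in> parcs H then \<sigma>(v := c) else \<sigma>)
       (pmf_of_set (pverts H))"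

definition glauber ::
  "'a pair_pre_digraph \<Rightarrow> 'c pair_pre_digraph \<Rightarrow> ('a \<Rightarrow> 'c) \<Rightarrow> ('a \<Rightarrow> 'c) pmf" where
  "glauber G H \<sigma> = bind_pmf (pmf_of_set (pverts G)) (\<lambda>v. metropolis G H v \<sigma>)"

definition systematic_scan ::
  "nat pair_pre_digraph \<Rightarrow> 'c pair_pre_digraph \<Rightarrow> (nat \<Rightarrow> 'c) \<Rightarrow> (nat \<Rightarrow> 'c) pmf" where
  "systematic_scan G H \<sigma> =
     fold (\<lambda>v \<mu>. bind_pmf \<mu> (metropolis G H v)) (sorted_list_of_set (pverts G)) (return_pmf \<sigma>)"

text \<open>
  In the following, a Markov chain on \<open>\<Omega>\<close> with stationary distribution \<open>\<pi>\<close> is given by its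
  transition kernel \<open>K\<close>; its transition matrix is \<open>P(x,y) = pmf (K x) y\<close>.
\<close>

definition dirichlet_form :: "'s set \<Rightarrow> 's pmf \<Rightarrow> ('s \<Rightarrow> 's pmf) \<Rightarrow> ('s \<Rightarrow> real) \<Rightarrow> real" where
  "dirichlet_form \<Omega> \<pi> K f =
     1 / 2 * (\<Sum>x\<in>\<Omega>. \<Sum>y\<in>\<Omega>. pmf \<pi> x * pmf (K x) y * (f x - f y)\<^sup>2)"

definition variance_on :: "'s set \<Rightarrow> 's pmf \<Rightarrow> ('s \<Rightarrow> real) \<Rightarrow> real" where
  "variance_on \<Omega> \<pi> f = (\<Sum>x\<in>\<Omega>. pmf \<pi> x * (f x - measure_pmf.expectation \<pi> f)\<^sup>2)"

text \<open>
  The infimum is taken in the extended reals: if \<open>\<Omega>\<close> has at most one element, there is no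
  nonconstant function and the value is \<open>\<infinity>\<close>.
\<close>

definition poincare_constant :: "'s set \<Rightarrow> 's pmf \<Rightarrow> ('s \<Rightarrow> 's pmf) \<Rightarrow> ereal" where
  "poincare_constant \<Omega> \<pi> K =
     (INF f \<in> {f. \<not> f constant_on \<Omega>}. ereal (dirichlet_form \<Omega> \<pi> K f / variance_on \<Omega> \<pi> f))"

definition lambda_glauber :: "'a pair_pre_digraph \<Rightarrow> 'c pair_pre_digraph \<Rightarrow> ereal" where
  "lambda_glauber G H =
     poincare_constant (colorings G H) (pmf_of_set (colorings G H)) (glauber G H)"

definition lambda_scan :: "nat pair_pre_digraph \<Rightarrow> 'c pair_pre_digraph \<Rightarrow> ereal" where
  "lambda_scan G H =
     poincare_constant (colorings G H) (pmf_of_set (colorings G H)) (systematic_scan G H)"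

end

theory Submission
  imports Defs
begin

text \<open>
  The comparison holds for the Dirichlet forms of every single function \<open>f\<close>, with the constant
  \<open>2^(\<Delta> + 1)\<close>. A nonconstant \<open>f\<close> exists only if there are at least two colors, and then this
  constant is below \<open>4 q^(\<Delta> + 1)\<close>. If there is no nonconstant function, both Poincare constants
  are \<open>\<infinity>\<close>.

  Let \<open>P\<^sub>v\<close> be the transition operator of the Metropolis update at \<open>v\<close>. It is symmetric with
  \<open>0 \<le> P\<^sub>v \<le> I\<close>, since it lazily averages over the colorings that agree off \<open>v\<close>
  (\<open>positive_contraction_lazy_class_average\<close>), and \<open>P\<^sub>v\<close> and \<open>P\<^sub>w\<close> commute for nonadjacent \<open>v\<close>, \<open>w\<close>.
  Write \<open>E\<^sub>v f = \<langle>f, (I - P\<^sub>v) f\<rangle>\<close>. Up to the same normalisation, the Dirichlet form of Glauber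
  dynamics is the average of the \<open>E\<^sub>v f\<close>, and that of the scan \<open>S = P\<^sub>1 \<cdots> P\<^sub>n\<close> is
  \<open>\<langle>f, f - S f\<rangle> \<ge> (\<parallel>f\<parallel>\<^sup>2 - \<parallel>S f\<parallel>\<^sup>2) / 2\<close>. The loss \<open>\<parallel>f\<parallel>\<^sup>2 - \<parallel>S f\<parallel>\<^sup>2\<close> is the sum of the losses
  \<open>D\<^sub>w = \<parallel>g\<parallel>\<^sup>2 - \<parallel>P\<^sub>w g\<parallel>\<^sup>2\<close> of the successive steps of the scan, where \<open>g\<close> is the function that the
  step at \<open>w\<close> acts on. So it suffices to bound each \<open>E\<^sub>v f\<close> by \<open>2^\<Delta>\<close> times the total loss.

  Follow \<open>E\<^sub>v\<close> while \<open>P\<^sub>n\<close>, then \<open>P\<^sub>n\<^sub>-\<^sub>1\<close>, and so on down to \<open>P\<^sub>v\<close> are applied. A step \<open>P\<^sub>w\<close> that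
  commutes with \<open>P\<^sub>v\<close> satisfies \<open>E\<^sub>v g \<le> E\<^sub>v (P\<^sub>w g) + D\<^sub>w\<close> (\<open>energy_step_commuting\<close>); any other
  step satisfies this with an additional factor \<open>2\<close> (\<open>energy_step\<close>), and there are at most \<open>\<Delta>\<close>
  such steps. When \<open>P\<^sub>v\<close> is reached, the remaining energy is at most \<open>D\<^sub>v\<close>. This is
  \<open>energy_le_sweep_energy\<close>.

  The inequality for a commuting step amounts to \<open>P\<^sub>w P\<^sub>v P\<^sub>w \<le> P\<^sub>v\<close>. It is derived without spectral
  theory from the log-convexity of \<open>\<langle>P\<^sub>w\<^sup>k g, P\<^sub>v P\<^sub>w\<^sup>k g\<rangle>\<close> in \<open>k\<close>.
\<close>

section \<open>Symmetric operators between zero and the identity\<close>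

text \<open>
  The form is left unnormalised. Under the uniform distribution it is \<open>card \<Omega>\<close> times the
  \<open>L\<^sup>2\<close> inner product, and this factor is common to both Dirichlet forms.
\<close>

definition ip :: "'s set \<Rightarrow> ('s \<Rightarrow> real) \<Rightarrow> ('s \<Rightarrow> real) \<Rightarrow> real" where
  "ip \<Omega> f g = (\<Sum>x\<in>\<Omega>. f x * g x)"

lemma ip_commute: "ip \<Omega> f g = ip \<Omega> g f"
  by (simp add: ip_def mult.commute)

lemma ip_linear_left: "ip \<Omega> (\<lambda>x. a * f x + b * g x) h = a * ip \<Omega> f h + b * ip \<Omega> g h"
  by (simp add: ip_def sum_distrib_left sum.distrib algebra_simps)

lemma ip_linear_right: "ip \<Omega> h (\<lambda>x. a * f x + b * g x) = a * ip \<Omega> h f + b * ip \<Omega> h g"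
  by (simp add: ip_def sum_distrib_left sum.distrib algebra_simps)

lemma ip_nonneg: "ip \<Omega> f f \<ge> 0"
  by (simp add: ip_def sum_nonneg)

definition energy :: "'s set \<Rightarrow> (('s \<Rightarrow> real) \<Rightarrow> 's \<Rightarrow> real) \<Rightarrow> ('s \<Rightarrow> real) \<Rightarrow> real" where
  "energy \<Omega> T f = ip \<Omega> f f - ip \<Omega> f (T f)"

text \<open>
  The drop of the squared norm under one application of \<open>T\<close>. It telescopes along a product of
  operators, which the energy does not.
\<close>

definition norm_loss :: "'s set \<Rightarrow> (('s \<Rightarrow> real) \<Rightarrow> 's \<Rightarrow> real) \<Rightarrow> ('s \<Rightarrow> real) \<Rightarrow> real" where
  "norm_loss \<Omega> T f = ip \<Omega> f f - ip \<Omega> (T f) (T f)"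

text \<open>
  The two sides differ by \<open>\<parallel>f - T f\<parallel>\<^sup>2\<close>. The bound is meant for the systematic scan, which is a
  product of symmetric operators but in general not symmetric itself.
\<close>

lemma norm_loss_le_twice_energy: "norm_loss \<Omega> T f \<le> 2 * energy \<Omega> T f"
proof -
  have "0 \<le> ip \<Omega> (\<lambda>x. 1 * f x + (-1) * T f x) (\<lambda>x. 1 * f x + (-1) * T f x)"
    by (rule ip_nonneg)
  also have "\<dots> = ip \<Omega> f f - 2 * ip \<Omega> f (T f) + ip \<Omega> (T f) (T f)"
    unfolding ip_linear_left ip_linear_right by (simp add: ip_commute[of \<Omega> "T f" f])
  finally show ?thesis by (simp add: norm_loss_def energy_def)
qed

text \<open>
  The self-adjoint operators \<open>T\<close> on \<open>L\<^sup>2(\<Omega>)\<close> with \<open>0 \<le> T \<le> I\<close> in the order of quadratic forms.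
  Linearity is an equation between functions on the whole type, while the conditions on the form
  see only \<open>\<Omega>\<close>.
\<close>

locale positive_contraction =
  fixes \<Omega> :: "'s set" and T :: "('s \<Rightarrow> real) \<Rightarrow> 's \<Rightarrow> real"
  assumes linear: "T (\<lambda>x. a * f x + b * g x) = (\<lambda>x. a * T f x + b * T g x)"
    and symmetric: "ip \<Omega> (T f) g = ip \<Omega> f (T g)"
    and positive: "0 \<le> ip \<Omega> f (T f)"
    and contractive: "ip \<Omega> f (T f) \<le> ip \<Omega> f f"
begin

lemma cauchy_schwarz: "(ip \<Omega> f (T g))\<^sup>2 \<le> ip \<Omega> f (T f) * ip \<Omega> g (T g)"
proof -
  let ?a = "ip \<Omega> f (T f)" and ?b = "ip \<Omega> f (T g)" and ?c = "ip \<Omega> g (T g)"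
  have sym: "ip \<Omega> g (T f) = ?b"
    using symmetric[of g f] ip_commute[of \<Omega> f "T g"] by simp
  have quad: "0 \<le> s\<^sup>2 * ?a + 2 * s * t * ?b + t\<^sup>2 * ?c" for s t
  proof -
    have "0 \<le> ip \<Omega> (\<lambda>x. s * f x + t * g x) (T (\<lambda>x. s * f x + t * g x))"
      by (rule positive)
    also have "\<dots> = s\<^sup>2 * ?a + 2 * s * t * ?b + t\<^sup>2 * ?c"
      unfolding linear ip_linear_left ip_linear_right sym
      by (simp add: power2_eq_square algebra_simps)
    finally show ?thesis .
  qed
  \<comment> \<open>The quadratic form is nonnegative on the span of \<open>f\<close> and \<open>g\<close>; the inequality says that
    its discriminant is not positive.\<close>
  show ?thesis
  proof (cases "?c = 0")
    case True
    have "?b = 0"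
    proof (rule ccontr)
      assume b: "?b \<noteq> 0"
      have "0 \<le> ?a + 2 * (- (?a + 1) / (2 * ?b)) * ?b"
        using quad[of 1 "- (?a + 1) / (2 * ?b)"] True by simp
      also have "\<dots> = - 1" using b by (simp add: field_simps)
      finally show False by simp
    qed
    then show ?thesis by (simp add: True)
  next
    case False
    then have c: "?c > 0" using positive[of g] by simp
    have "0 \<le> ?c\<^sup>2 * ?a + 2 * ?c * (- ?b) * ?b + (- ?b)\<^sup>2 * ?c"
      by (rule quad)
    also have "\<dots> = ?c * (?a * ?c - ?b\<^sup>2)"
      by (simp add: power2_eq_square algebra_simps)
    finally show ?thesis using c by (simp add: zero_le_mult_iff)
  qed
qed

text \<open>
  This is \<open>T\<^sup>2 \<le> T\<close>. Instead of diagonalising \<open>T\<close>, apply the Cauchy-Schwarz inequality of the form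
  \<open>\<langle>f, T g\<rangle>\<close> to \<open>f\<close> and \<open>T f\<close>, and then \<open>T \<le> I\<close> to the factor \<open>\<langle>T f, T (T f)\<rangle>\<close>.
\<close>

lemma firmly_nonexpansive: "ip \<Omega> (T f) (T f) \<le> ip \<Omega> f (T f)"
proof (cases "ip \<Omega> (T f) (T f) = 0")
  case True
  then show ?thesis using positive by simp
next
  case False
  then have pos: "ip \<Omega> (T f) (T f) > 0" using ip_nonneg[of \<Omega> "T f"] by simp
  have "(ip \<Omega> (T f) (T f))\<^sup>2 = (ip \<Omega> f (T (T f)))\<^sup>2"
    by (simp add: symmetric)
  also have "\<dots> \<le> ip \<Omega> f (T f) * ip \<Omega> (T f) (T (T f))"
    by (rule cauchy_schwarz)
  also have "\<dots> \<le> ip \<Omega> f (T f) * ip \<Omega> (T f) (T f)"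
    by (intro mult_left_mono contractive positive)
  finally show ?thesis using pos by (simp add: power2_eq_square)
qed

lemma norm_loss_nonneg: "norm_loss \<Omega> T f \<ge> 0"
  unfolding norm_loss_def using firmly_nonexpansive[of f] contractive[of f] by linarith

text \<open>
  This is \<open>I - T \<le> I - T\<^sup>2\<close>. Positivity is essential: for \<open>T = -I\<close> no norm is lost, but the
  energy of a function that does not vanish on \<open>\<Omega>\<close> is positive.
\<close>

lemma energy_le_norm_loss: "energy \<Omega> T f \<le> norm_loss \<Omega> T f"
  unfolding norm_loss_def energy_def using firmly_nonexpansive[of f] by linarith

lemma energy_nonneg: "energy \<Omega> T f \<ge> 0"
  unfolding energy_def using contractive[of f] by simp

lemma energy_le_norm: "energy \<Omega> T f \<le> ip \<Omega> f f"
  unfolding energy_def using positive[of f] by simp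

text \<open>
  The explicit coefficients put the arguments into the shape of the linearity law.
\<close>

lemma energy_parallelogram:
  "energy \<Omega> T (\<lambda>x. 1 * f x + 1 * g x) + energy \<Omega> T (\<lambda>x. 1 * f x + (- 1) * g x)
    = 2 * energy \<Omega> T f + 2 * energy \<Omega> T g"
  unfolding energy_def linear ip_linear_left ip_linear_right by simp

lemma sum_preserving:
  assumes "T (\<lambda>_. 1) = (\<lambda>_. 1)"
  shows "(\<Sum>x\<in>\<Omega>. T f x) = (\<Sum>x\<in>\<Omega>. f x)"
  using symmetric[of "\<lambda>_. 1" f] assms by (simp add: ip_def)

end

text \<open>
  The ratios \<open>\<phi> (k + 1) / \<phi> k\<close> of a log-convex sequence do not decrease. If the first one exceeded
  \<open>1\<close>, the sequence would grow at least geometrically.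
\<close>

lemma log_convex_bounded_imp_nonincreasing:
  fixes \<phi> :: "nat \<Rightarrow> real"
  assumes nonneg: "\<And>k. \<phi> k \<ge> 0" and bounded: "\<And>k. \<phi> k \<le> M"
    and log_convex: "\<And>k. (\<phi> (Suc k))\<^sup>2 \<le> \<phi> k * \<phi> (Suc (Suc k))"
  shows "\<phi> 1 \<le> \<phi> 0"
proof (rule ccontr)
  assume "\<not> \<phi> 1 \<le> \<phi> 0"
  then have incr: "\<phi> 0 < \<phi> 1" by simp
  have "\<phi> 0 \<noteq> 0"
  proof
    assume "\<phi> 0 = 0"
    then show False using log_convex[of 0] incr by simp
  qed
  then have pos: "\<phi> 0 > 0" using nonneg[of 0] by simp
  define r where "r = \<phi> 1 / \<phi> 0"
  have r: "r > 1" using incr pos by (simp add: r_def)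
  have step: "\<phi> k > 0 \<and> r * \<phi> k \<le> \<phi> (Suc k)" for k
  proof (induction k)
    case 0
    then show ?case using pos by (simp add: r_def)
  next
    case (Suc k)
    then have k: "\<phi> k > 0" "r * \<phi> k \<le> \<phi> (Suc k)" by auto
    have k': "\<phi> (Suc k) > 0" using k r by (smt (verit) mult_pos_pos)
    have "\<phi> k * (r * \<phi> (Suc k)) \<le> \<phi> (Suc k) * \<phi> (Suc k)"
      using mult_right_mono[OF k(2), of "\<phi> (Suc k)"] k' by (simp add: mult_ac)
    also have "\<dots> \<le> \<phi> k * \<phi> (Suc (Suc k))"
      using log_convex[of k] by (simp add: power2_eq_square)
    finally show ?case using k k' by simp
  qed
  have growth: "r ^ k * \<phi> 0 \<le> \<phi> k" for k
  proof (induction k)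
    case (Suc k)
    have "r ^ Suc k * \<phi> 0 = r * (r ^ k * \<phi> 0)" by simp
    also have "\<dots> \<le> r * \<phi> k" using Suc r by simp
    also have "\<dots> \<le> \<phi> (Suc k)" using step by simp
    finally show ?case .
  qed simp
  obtain k where "M / \<phi> 0 < r ^ k"
    using real_arch_pow[OF r] by blast
  then have "M < r ^ k * \<phi> 0" using pos by (simp add: field_simps)
  with growth[of k] bounded[of k] show False by simp
qed

text \<open>
  In the operator order this is \<open>B A B \<le> A\<close>, which one would get from a square root of \<open>A\<close> that
  commutes with \<open>B\<close>. The sequence \<open>\<langle>B\<^sup>k f, A B\<^sup>k f\<rangle>\<close> avoids the square root: it is log-convex by the
  Cauchy-Schwarz inequality, because commutation and symmetry allow one factor \<open>B\<close> to be moved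
  from the left argument to the right one, and it is bounded because \<open>B\<close> shrinks norms.
\<close>

lemma quadratic_form_contracts_if_commute:
  assumes A: "positive_contraction \<Omega> A" and B: "positive_contraction \<Omega> B"
    and commute: "\<And>f. A (B f) = B (A f)"
  shows "ip \<Omega> (B f) (A (B f)) \<le> ip \<Omega> f (A f)"
proof -
  interpret A: positive_contraction \<Omega> A by fact
  interpret B: positive_contraction \<Omega> B by fact
  define \<phi> where "\<phi> k = ip \<Omega> ((B ^^ k) f) (A ((B ^^ k) f))" for k
  have "\<phi> 1 \<le> \<phi> 0"
  proof (rule log_convex_bounded_imp_nonincreasing)
    show "\<phi> k \<ge> 0" for k
      unfolding \<phi>_def by (rule A.positive)
    have norm: "ip \<Omega> ((B ^^ k) f) ((B ^^ k) f) \<le> ip \<Omega> f f" for k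
    proof (induction k)
      case (Suc k)
      then show ?case
        using B.norm_loss_nonneg[of "(B ^^ k) f"] by (simp add: norm_loss_def)
    qed simp
    show "\<phi> k \<le> ip \<Omega> f f" for k
      unfolding \<phi>_def using A.contractive[of "(B ^^ k) f"] norm[of k] by linarith
    show "(\<phi> (Suc k))\<^sup>2 \<le> \<phi> k * \<phi> (Suc (Suc k))" for k
    proof -
      let ?g = "(B ^^ k) f"
      have "\<phi> (Suc k) = ip \<Omega> ?g (A (B (B ?g)))"
        by (simp add: \<phi>_def B.symmetric commute)
      then show ?thesis
        using A.cauchy_schwarz[of ?g "B (B ?g)"] by (simp add: \<phi>_def)
    qed
  qed
  then show ?thesis by (simp add: \<phi>_def)
qed

section \<open>Energies along a product of operators\<close>

text \<open>
  The coefficient \<open>1\<close> is what makes the final bound independent of the number of vertices: along a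
  sweep all but at most \<open>\<Delta>\<close> of the later updates commute with a given one, and each of them costs
  only its own norm loss.
\<close>

lemma energy_step_commuting:
  assumes "positive_contraction \<Omega> A" "positive_contraction \<Omega> B" "\<And>f. A (B f) = B (A f)"
  shows "energy \<Omega> A f \<le> energy \<Omega> A (B f) + norm_loss \<Omega> B f"
  using quadratic_form_contracts_if_commute[OF assms, of f]
  by (simp add: energy_def norm_loss_def)

text \<open>
  Without commutation, split \<open>f = B f + (f - B f)\<close>. The square root of the energy is a seminorm
  bounded by the norm, and \<open>\<parallel>f - B f\<parallel>\<^sup>2\<close> is at most the norm loss of \<open>B\<close>. The price is a factor \<open>2\<close>.
\<close>

lemma energy_step:
  assumes A: "positive_contraction \<Omega> A" and B: "positive_contraction \<Omega> B"
  shows "energy \<Omega> A f \<le> 2 * (energy \<Omega> A (B f) + norm_loss \<Omega> B f)"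
proof -
  interpret A: positive_contraction \<Omega> A by fact
  interpret B: positive_contraction \<Omega> B by fact
  define d where "d = (\<lambda>x. 1 * f x + (- 1) * B f x)"
  have "ip \<Omega> d d = ip \<Omega> f f - 2 * ip \<Omega> f (B f) + ip \<Omega> (B f) (B f)"
    unfolding d_def ip_linear_left ip_linear_right by (simp add: ip_commute[of \<Omega> "B f" f])
  then have d: "ip \<Omega> d d \<le> norm_loss \<Omega> B f"
    using B.firmly_nonexpansive[of f] by (simp add: norm_loss_def)
  have "energy \<Omega> A f = energy \<Omega> A (\<lambda>x. 1 * B f x + 1 * d x)"
    by (simp add: d_def)
  also have "\<dots> \<le> 2 * energy \<Omega> A (B f) + 2 * energy \<Omega> A d"
    using A.energy_parallelogram[of "B f" d] A.energy_nonneg[of "\<lambda>x. 1 * B f x + (- 1) * d x"]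
    by linarith
  also have "\<dots> \<le> 2 * (energy \<Omega> A (B f) + norm_loss \<Omega> B f)"
    using A.energy_le_norm[of d] d by simp
  finally show ?thesis .
qed

lemma norm_loss_foldr_nonneg:
  assumes "\<And>w. w \<in> set ws \<Longrightarrow> positive_contraction \<Omega> (P w)"
  shows "norm_loss \<Omega> (foldr P ws) f \<ge> 0"
  using assms
proof (induction ws)
  case (Cons w ws)
  have "norm_loss \<Omega> (foldr P ws) f \<ge> 0" using Cons by simp
  moreover have "norm_loss \<Omega> (P w) (foldr P ws f) \<ge> 0"
    using Cons.prems by (intro positive_contraction.norm_loss_nonneg) simp
  ultimately show ?case by (simp add: norm_loss_def)
qed (simp add: norm_loss_def)

text \<open>
  The predicate \<open>N\<close> marks the operators that need not commute with \<open>A\<close>; only they contribute a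
  factor \<open>2\<close>. The norm losses of the single factors telescope to the one of the product.
\<close>

lemma energy_le_pow_norm_loss_foldr:
  assumes "positive_contraction \<Omega> A"
    and "\<And>w. w \<in> set ws \<Longrightarrow> positive_contraction \<Omega> (P w)"
    and "\<And>w f. w \<in> set ws \<Longrightarrow> \<not> N w \<Longrightarrow> A (P w f) = P w (A f)"
  shows "energy \<Omega> A f
    \<le> 2 ^ length (filter N ws) * (energy \<Omega> A (foldr P ws f) + norm_loss \<Omega> (foldr P ws) f)"
  using assms(2,3)
proof (induction ws)
  case Nil
  then show ?case by (simp add: norm_loss_def)
next
  case (Cons w ws)
  \<comment> \<open>In the product the head of the list is applied last.\<close>
  let ?g = "foldr P ws f" and ?c = "if N w then 2 else 1 :: real"
  let ?D = "norm_loss \<Omega> (foldr P ws) f"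
  have w: "positive_contraction \<Omega> (P w)" using Cons.prems by simp
  have D: "?D \<ge> 0" using Cons.prems by (intro norm_loss_foldr_nonneg) simp
  have "energy \<Omega> A ?g \<le> ?c * (energy \<Omega> A (P w ?g) + norm_loss \<Omega> (P w) ?g)"
    using energy_step[OF assms(1) w, of ?g] energy_step_commuting[OF assms(1) w, of ?g] Cons.prems
    by auto
  moreover have "?D \<le> ?c * ?D" using D by simp
  ultimately have "energy \<Omega> A ?g + ?D
      \<le> ?c * (energy \<Omega> A (P w ?g) + (norm_loss \<Omega> (P w) ?g + ?D))"
    by (auto split: if_splits)
  also have "norm_loss \<Omega> (P w) ?g + ?D = norm_loss \<Omega> (foldr P (w # ws)) f"
    by (simp add: norm_loss_def)
  finally have step: "2 ^ length (filter N ws) * (energy \<Omega> A ?g + ?D)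
      \<le> 2 ^ length (filter N ws) *
        (?c * (energy \<Omega> A (P w ?g) + norm_loss \<Omega> (foldr P (w # ws)) f))"
    by (rule mult_left_mono) simp
  have "energy \<Omega> A f \<le> 2 ^ length (filter N ws) * (energy \<Omega> A ?g + ?D)"
    using Cons by simp
  also note step
  also have "2 ^ length (filter N ws) *
        (?c * (energy \<Omega> A (P w ?g) + norm_loss \<Omega> (foldr P (w # ws)) f))
      = 2 ^ length (filter N (w # ws)) *
        (energy \<Omega> A (foldr P (w # ws) f) + norm_loss \<Omega> (foldr P (w # ws)) f)"
    by simp
  finally show ?case .
qed

text \<open>
  The operators to the right of \<open>v\<close> are applied before \<open>P v\<close>. The energy of \<open>P v\<close> is pushed through
  them until \<open>P v\<close> itself is applied; there the energy is at most the norm that \<open>P v\<close> removes, so it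
  too is paid for by the norm loss of the sweep. The factors to the left of \<open>v\<close> only shrink norms.
\<close>

lemma energy_le_sweep_energy:
  assumes "vs = as @ v # bs"
    and pc: "\<And>w. w \<in> set vs \<Longrightarrow> positive_contraction \<Omega> (P w)"
    and comm: "\<And>w f. w \<in> set bs \<Longrightarrow> \<not> N w \<Longrightarrow> P v (P w f) = P w (P v f)"
    and deg: "length (filter N bs) \<le> \<Delta>"
  shows "energy \<Omega> (P v) f \<le> 2 ^ (\<Delta> + 1) * energy \<Omega> (foldr P vs) f"
proof -
  let ?g = "foldr P bs f"
  have v: "positive_contraction \<Omega> (P v)" using assms by simp
  have "norm_loss \<Omega> (foldr P as) (P v ?g) \<ge> 0"
    using assms by (intro norm_loss_foldr_nonneg) simp
  then have le: "energy \<Omega> (P v) ?g + norm_loss \<Omega> (foldr P bs) f \<le> norm_loss \<Omega> (foldr P vs) f"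
    using positive_contraction.energy_le_norm_loss[OF v, of ?g] assms(1)
    by (simp add: norm_loss_def)
  have nonneg: "norm_loss \<Omega> (foldr P vs) f \<ge> 0"
    by (intro norm_loss_foldr_nonneg pc)
  have "energy \<Omega> (P v) f \<le> 2 ^ length (filter N bs) *
      (energy \<Omega> (P v) ?g + norm_loss \<Omega> (foldr P bs) f)"
    using assms by (intro energy_le_pow_norm_loss_foldr v) auto
  also have "\<dots> \<le> 2 ^ length (filter N bs) * norm_loss \<Omega> (foldr P vs) f"
    using le by simp
  also have "\<dots> \<le> 2 ^ \<Delta> * norm_loss \<Omega> (foldr P vs) f"
    using deg nonneg by (intro mult_right_mono power_increasing) auto
  also have "\<dots> \<le> 2 ^ \<Delta> * (2 * energy \<Omega> (foldr P vs) f)"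
    by (intro mult_left_mono norm_loss_le_twice_energy) simp
  finally show ?thesis by simp
qed

section \<open>Averaging over classes\<close>

text \<open>
  A chain that moves to each other point of its \<open>\<kappa>\<close>-class with probability \<open>1/q\<close>, and stays put
  otherwise. Its kernel is symmetric, which gives symmetry and \<open>T \<le> I\<close>. For positivity write
  \<open>T = D + J/q\<close>: \<open>J\<close> sums over the class, so its quadratic form is a sum of squares of class sums,
  and the diagonal part \<open>D\<close> is nonnegative because no class has more than \<open>q\<close> points.
\<close>

lemma positive_contraction_lazy_class_average:
  fixes \<kappa> :: "'s \<Rightarrow> 'k" and q :: real
  assumes fin: "finite \<Omega>"
    and lin: "\<And>a b f g. T (\<lambda>x. a * f x + b * g x) = (\<lambda>x. a * T f x + b * T g x)"
    and T: "\<And>f x. x \<in> \<Omega> \<Longrightarrow> T f x = f x + (\<Sum>y | y \<in> \<Omega> \<and> \<kappa> y = \<kappa> x. f y - f x) / q"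
    and card: "\<And>x. x \<in> \<Omega> \<Longrightarrow> card {y \<in> \<Omega>. \<kappa> y = \<kappa> x} \<le> q"
    and q: "q > 0"
  shows "positive_contraction \<Omega> T"
proof -
  define C where "C x = {y \<in> \<Omega>. \<kappa> y = \<kappa> x}" for x
  define J where "J f g = (\<Sum>x\<in>\<Omega>. \<Sum>y\<in>C x. f x * g y)" for f g :: "'s \<Rightarrow> real"
  have swap: "(\<Sum>x\<in>\<Omega>. \<Sum>y\<in>C x. h x y) = (\<Sum>x\<in>\<Omega>. \<Sum>y\<in>C x. h y x)" for h :: "'s \<Rightarrow> 's \<Rightarrow> real"
  proof -
    have "(\<Sum>x\<in>\<Omega>. \<Sum>y\<in>C x. h x y) = (\<Sum>y\<in>\<Omega>. \<Sum>x | x \<in> \<Omega> \<and> \<kappa> y = \<kappa> x. h x y)"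
      unfolding C_def by (rule sum.swap_restrict) (use fin in auto)
    then show ?thesis unfolding C_def by (simp add: eq_commute)
  qed
  have ip_T: "ip \<Omega> f (T g) = (\<Sum>x\<in>\<Omega>. (1 - card (C x) / q) * (f x * g x)) + J f g / q" for f g
  proof -
    have "f x * T g x = (1 - card (C x) / q) * (f x * g x) + (\<Sum>y\<in>C x. f x * g y) / q"
      if "x \<in> \<Omega>" for x
    proof -
      have "T g x = (1 - card (C x) / q) * g x + (\<Sum>y\<in>C x. g y) / q"
        using T[OF that, of g] q by (simp add: C_def[symmetric] sum_subtractf field_simps)
      then show ?thesis
        by (simp only: sum_distrib_left[symmetric]) (simp add: distrib_left mult_ac)
    qed
    then show ?thesis
      unfolding ip_def J_def by (simp add: sum.distrib sum_divide_distrib)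
  qed
  have J_nonneg: "J f f \<ge> 0" for f
  proof -
    have "J f f = (\<Sum>k\<in>\<kappa> ` \<Omega>. \<Sum>x | x \<in> \<Omega> \<and> \<kappa> x = k. \<Sum>y\<in>C x. f x * f y)"
      unfolding J_def using fin by (rule sum.image_gen)
    also have "\<dots> = (\<Sum>k\<in>\<kappa> ` \<Omega>. (\<Sum>x | x \<in> \<Omega> \<and> \<kappa> x = k. f x)\<^sup>2)"
      by (intro sum.cong refl) (auto simp: C_def power2_eq_square sum_product)
    also have "\<dots> \<ge> 0" by (simp add: sum_nonneg)
    finally show ?thesis .
  qed
  show ?thesis
  proof
    show "T (\<lambda>x. a * f x + b * g x) = (\<lambda>x. a * T f x + b * T g x)" for a b f g
      by (rule lin)
    show "ip \<Omega> (T f) g = ip \<Omega> f (T g)" for f g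
    proof -
      have "J g f = J f g"
        unfolding J_def by (subst swap) (simp add: mult.commute)
      then show ?thesis
        unfolding ip_commute[of \<Omega> "T f" g] ip_T by (simp add: mult.commute)
    qed
    show "0 \<le> ip \<Omega> f (T f)" for f
    proof -
      have "(1 - card (C x) / q) * (f x * f x) \<ge> 0" if "x \<in> \<Omega>" for x
        using card[OF that] q by (intro mult_nonneg_nonneg[OF _ zero_le_square]) (simp add: C_def)
      then have "(\<Sum>x\<in>\<Omega>. (1 - card (C x) / q) * (f x * f x)) \<ge> 0"
        by (rule sum_nonneg)
      then show ?thesis using J_nonneg[of f] q by (simp add: ip_T)
    qed
    show "ip \<Omega> f (T f) \<le> ip \<Omega> f f" for f
    proof -
      have "0 \<le> (\<Sum>x\<in>\<Omega>. \<Sum>y\<in>C x. (f x - f y)\<^sup>2)"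
        by (simp add: sum_nonneg)
      also have "\<dots> = (\<Sum>x\<in>\<Omega>. \<Sum>y\<in>C x. f x * f x) + (\<Sum>x\<in>\<Omega>. \<Sum>y\<in>C x. f y * f y) - 2 * J f f"
        unfolding J_def
        by (simp add: power2_eq_square algebra_simps sum.distrib sum_subtractf sum_distrib_left)
      also have "\<dots> = 2 * ((\<Sum>x\<in>\<Omega>. card (C x) * (f x * f x)) - J f f)"
        using swap[of "\<lambda>x y. f y * f y"] by simp
      finally have "J f f / q \<le> (\<Sum>x\<in>\<Omega>. card (C x) * (f x * f x)) / q"
        using q by (simp add: divide_right_mono)
      moreover have "(\<Sum>x\<in>\<Omega>. (1 - card (C x) / q) * (f x * f x))
          = ip \<Omega> f f - (\<Sum>x\<in>\<Omega>. card (C x) * (f x * f x)) / q"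
        by (simp add: ip_def left_diff_distrib sum_subtractf sum_divide_distrib)
      ultimately show ?thesis by (simp add: ip_T)
    qed
  qed
qed

section \<open>Dirichlet forms of uniform chains\<close>

text \<open>
  The systematic scan is in general not reversible, so the usual identity for the Dirichlet form
  has to come from stationarity alone. Expanding the square leaves \<open>f\<^sup>2\<close> and \<open>T (f\<^sup>2)\<close>, whose sums over
  \<open>\<Omega>\<close> agree by stationarity of the uniform distribution.
\<close>

lemma dirichlet_form_uniform:
  assumes fin: "finite \<Omega>" and ne: "\<Omega> \<noteq> {}"
    and closed: "\<And>x. x \<in> \<Omega> \<Longrightarrow> set_pmf (K x) \<subseteq> \<Omega>"
    and T: "\<And>h x. T h x = measure_pmf.expectation (K x) h"
    and stat: "\<And>h. (\<Sum>x\<in>\<Omega>. T h x) = (\<Sum>x\<in>\<Omega>. h x)"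
  shows "dirichlet_form \<Omega> (pmf_of_set \<Omega>) K f = energy \<Omega> T f / card \<Omega>"
proof -
  have T_sum: "T h x = (\<Sum>y\<in>\<Omega>. h y * pmf (K x) y)" if "x \<in> \<Omega>" for h x
    unfolding T using closed[OF that] fin by (intro integral_measure_pmf_real) auto
  have mass: "(\<Sum>y\<in>\<Omega>. pmf (K x) y) = 1" if "x \<in> \<Omega>" for x
    using closed[OF that] fin by (intro sum_pmf_eq_1)
  have "(\<Sum>y\<in>\<Omega>. pmf (pmf_of_set \<Omega>) x * pmf (K x) y * (f x - f y)\<^sup>2)
      = (f x * f x - 2 * (f x * T f x) + T (\<lambda>y. f y * f y) x) / card \<Omega>" if "x \<in> \<Omega>" for x
  proof -
    have "(\<Sum>y\<in>\<Omega>. pmf (K x) y * (f x - f y)\<^sup>2)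
        = f x * f x * (\<Sum>y\<in>\<Omega>. pmf (K x) y) - 2 * (f x * T f x) + T (\<lambda>y. f y * f y) x"
      unfolding T_sum[OF that]
      by (simp add: power2_eq_square algebra_simps sum.distrib sum_subtractf sum_distrib_left)
    then show ?thesis
      using that fin ne mass[OF that]
      by (simp add: sum_distrib_left[symmetric] mult.assoc sum_divide_distrib[symmetric])
  qed
  then have "dirichlet_form \<Omega> (pmf_of_set \<Omega>) K f
      = 1 / 2 * (\<Sum>x\<in>\<Omega>. (f x * f x - 2 * (f x * T f x) + T (\<lambda>y. f y * f y) x) / card \<Omega>)"
    unfolding dirichlet_form_def by simp
  also have "\<dots> = 1 / 2 * ((ip \<Omega> f f - 2 * ip \<Omega> f (T f) + (\<Sum>x\<in>\<Omega>. T (\<lambda>y. f y * f y) x)) / card \<Omega>)"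
    by (simp only: ip_def sum_divide_distrib[symmetric] sum.distrib sum_subtractf sum_distrib_left)
  also have "\<dots> = 1 / 2 * (2 * energy \<Omega> T f / card \<Omega>)"
    unfolding stat by (simp add: ip_def energy_def)
  finally show ?thesis by simp
qed

section \<open>The Metropolis update as an operator\<close>

definition recolor ::
  "'a pair_pre_digraph \<Rightarrow> 'c pair_pre_digraph \<Rightarrow> 'a \<Rightarrow> 'c \<Rightarrow> ('a \<Rightarrow> 'c) \<Rightarrow> 'a \<Rightarrow> 'c" where
  "recolor G H v c \<sigma> = (if \<forall>w. (v, w) \<in> parcs G \<longrightarrow> (c, \<sigma> w) \<in> parcs H then \<sigma>(v := c) else \<sigma>)"

text \<open>
  The transition operator of a Metropolis update. It is defined at every assignment of colors and
  not only at the colorings, so that commutation and the unfolding of the scan are equations between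
  functions.
\<close>

definition metropolis_op ::
  "'a pair_pre_digraph \<Rightarrow> 'c pair_pre_digraph \<Rightarrow> 'a \<Rightarrow> (('a \<Rightarrow> 'c) \<Rightarrow> real) \<Rightarrow> ('a \<Rightarrow> 'c) \<Rightarrow> real" where
  "metropolis_op G H v f \<sigma> = (\<Sum>c\<in>pverts H. f (recolor G H v c \<sigma>)) / card (pverts H)"

locale coloring_dynamics =
  fixes G :: "'a pair_pre_digraph" and H :: "'c pair_pre_digraph"
  assumes graph_G: "pair_graph G" and graph_H: "pair_pseudo_graph H" and colors: "pverts H \<noteq> {}"
begin

interpretation G: pair_graph G by (rule graph_G)
interpretation H: pair_pseudo_graph H by (rule graph_H)

abbreviation "\<Omega> \<equiv> colorings G H"
abbreviation "P \<equiv> metropolis_op G H"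

lemma finite_colorings: "finite \<Omega>"
proof (rule finite_subset)
  show "\<Omega> \<subseteq> pverts G \<rightarrow>\<^sub>E pverts H" by (auto simp: colorings_def)
qed (intro finite_PiE G.pair_finite_verts H.pair_finite_verts)

lemma card_colors_pos: "card (pverts H) > 0"
  using colors H.pair_finite_verts by (simp add: card_gt_0_iff)

lemma metropolis_recolor:
  "metropolis G H v \<sigma> = map_pmf (\<lambda>c. recolor G H v c \<sigma>) (pmf_of_set (pverts H))"
  by (simp add: metropolis_def recolor_def)

lemma set_metropolis: "set_pmf (metropolis G H v \<sigma>) = (\<lambda>c. recolor G H v c \<sigma>) ` pverts H"
  using colors H.pair_finite_verts by (simp add: metropolis_recolor set_pmf_of_set)

lemma finite_set_metropolis: "finite (set_pmf (metropolis G H v \<sigma>))"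
  by (simp add: set_metropolis H.pair_finite_verts)

lemma expectation_metropolis: "measure_pmf.expectation (metropolis G H v \<sigma>) f = P v f \<sigma>"
  using colors H.pair_finite_verts
  by (simp add: metropolis_recolor metropolis_op_def integral_pmf_of_set)

text \<open>
  Symmetry of \<open>H\<close> handles the arcs of \<open>G\<close> that end in \<open>v\<close>, and the absence of loops in \<open>G\<close> rules out
  that the new color would have to be adjacent to itself.
\<close>

lemma recolor_in_colorings:
  assumes "\<sigma> \<in> \<Omega>" "v \<in> pverts G" "c \<in> pverts H"
  shows "recolor G H v c \<sigma> \<in> \<Omega>"
proof (cases "\<forall>w. (v, w) \<in> parcs G \<longrightarrow> (c, \<sigma> w) \<in> parcs H")
  case True
  have "((\<sigma>(v := c)) i, (\<sigma>(v := c)) j) \<in> parcs H" if ij: "(i, j) \<in> parcs G" for i j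
  proof -
    have "(\<sigma> i, \<sigma> j) \<in> parcs H" using assms(1) ij by (simp add: colorings_def)
    moreover have "(\<sigma> i, c) \<in> parcs H" if "j = v"
      using True G.arcs_symmetric[OF ij] H.arcs_symmetric[of c "\<sigma> i"] that by simp
    ultimately show ?thesis
      using True ij G.no_loops'[OF ij] by auto
  qed
  moreover have "\<sigma>(v := c) \<in> pverts G \<rightarrow>\<^sub>E pverts H"
    using assms by (auto simp: colorings_def PiE_iff extensional_def)
  ultimately show ?thesis
    using True by (simp add: recolor_def colorings_def)
qed (use assms(1) in \<open>auto simp: recolor_def\<close>)

text \<open>
  The accepted proposals at \<open>v\<close> are exactly the colorings that agree with \<open>\<sigma>\<close> off \<open>v\<close>. Resetting
  the value at \<open>v\<close> to \<open>undefined\<close> is a class function for this equivalence relation.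
\<close>

lemma accepted_recolorings:
  assumes \<sigma>: "\<sigma> \<in> \<Omega>" and v: "v \<in> pverts G"
  shows "bij_betw (\<lambda>c. \<sigma>(v := c))
    {c \<in> pverts H. \<forall>w. (v, w) \<in> parcs G \<longrightarrow> (c, \<sigma> w) \<in> parcs H}
    {\<tau> \<in> \<Omega>. \<tau>(v := undefined) = \<sigma>(v := undefined)}" (is "bij_betw ?u ?A ?B")
proof (rule bij_betw_byWitness[where f' = "\<lambda>\<tau>. \<tau> v"])
  have off: "\<tau> w = \<sigma> w" if "\<tau>(v := undefined) = \<sigma>(v := undefined)" "w \<noteq> v" for \<tau> w
    using fun_cong[OF that(1), of w] that(2) by simp
  show "\<forall>\<tau>\<in>?B. ?u (\<tau> v) = \<tau>"
  proof (intro ballI ext)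
    fix \<tau> w assume "\<tau> \<in> ?B"
    then show "?u (\<tau> v) w = \<tau> w" using off[of \<tau> w] by (cases "w = v") auto
  qed
  show "?u ` ?A \<subseteq> ?B"
  proof (rule image_subsetI)
    fix c assume "c \<in> ?A"
    then have "recolor G H v c \<sigma> = \<sigma>(v := c)" "c \<in> pverts H" by (simp_all add: recolor_def)
    then show "\<sigma>(v := c) \<in> ?B" using recolor_in_colorings[OF \<sigma> v, of c] by simp
  qed
  show "(\<lambda>\<tau>. \<tau> v) ` ?B \<subseteq> ?A"
  proof safe
    fix \<tau> assume \<tau>: "\<tau> \<in> \<Omega>" "\<tau>(v := undefined) = \<sigma>(v := undefined)"
    show "\<tau> v \<in> pverts H" using \<tau> v by (auto simp: colorings_def)
    fix w assume w: "(v, w) \<in> parcs G"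
    then have "(\<tau> v, \<tau> w) \<in> parcs H" using \<tau>(1) by (simp add: colorings_def)
    then show "(\<tau> v, \<sigma> w) \<in> parcs H" using off[OF \<tau>(2), of w] G.no_loops'[OF w] by simp
  qed
qed auto

lemma metropolis_op_eq:
  assumes \<sigma>: "\<sigma> \<in> \<Omega>" and v: "v \<in> pverts G"
  shows "P v f \<sigma> = f \<sigma> +
    (\<Sum>\<tau> | \<tau> \<in> \<Omega> \<and> \<tau>(v := undefined) = \<sigma>(v := undefined). f \<tau> - f \<sigma>) / card (pverts H)"
proof -
  let ?ok = "\<lambda>c. \<forall>w. (v, w) \<in> parcs G \<longrightarrow> (c, \<sigma> w) \<in> parcs H"
  have "(\<Sum>c\<in>pverts H. f (recolor G H v c \<sigma>))
      = (\<Sum>c\<in>pverts H. f \<sigma> + (if ?ok c then f (\<sigma>(v := c)) - f \<sigma> else 0))"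
    by (intro sum.cong) (auto simp: recolor_def)
  also have "\<dots> = card (pverts H) * f \<sigma> + (\<Sum>c | c \<in> pverts H \<and> ?ok c. f (\<sigma>(v := c)) - f \<sigma>)"
    using H.pair_finite_verts by (simp only: sum.distrib sum_constant sum.inter_filter)
  also have "(\<Sum>c | c \<in> pverts H \<and> ?ok c. f (\<sigma>(v := c)) - f \<sigma>)
      = (\<Sum>\<tau> | \<tau> \<in> \<Omega> \<and> \<tau>(v := undefined) = \<sigma>(v := undefined). f \<tau> - f \<sigma>)"
    by (rule sum.reindex_bij_betw[OF accepted_recolorings[OF \<sigma> v], of "\<lambda>\<tau>. f \<tau> - f \<sigma>"])
  finally show ?thesis
    using colors H.pair_finite_verts by (simp add: metropolis_op_def add_divide_distrib)
qed

lemma metropolis_op_positive_contraction: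
  assumes v: "v \<in> pverts G"
  shows "positive_contraction \<Omega> (P v)"
proof (rule positive_contraction_lazy_class_average)
  show "P v (\<lambda>\<sigma>. a * f \<sigma> + b * g \<sigma>) = (\<lambda>\<sigma>. a * P v f \<sigma> + b * P v g \<sigma>)" for a b f g
    by (simp add: metropolis_op_def fun_eq_iff sum.distrib sum_distrib_left add_divide_distrib)
  show "real (card {\<tau> \<in> \<Omega>. \<tau>(v := undefined) = \<sigma>(v := undefined)}) \<le> real (card (pverts H))"
    if "\<sigma> \<in> \<Omega>" for \<sigma>
    unfolding bij_betw_same_card[OF accepted_recolorings[OF that v], symmetric]
    using H.pair_finite_verts by (auto intro: card_mono)
  show "P v f \<sigma> = f \<sigma> + (\<Sum>\<tau> | \<tau> \<in> \<Omega> \<and> \<tau>(v := undefined) = \<sigma>(v := undefined). f \<tau> - f \<sigma>)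
      / real (card (pverts H))" if "\<sigma> \<in> \<Omega>" for f \<sigma>
    by (rule metropolis_op_eq[OF that v])
  show "real (card (pverts H)) > 0" by (simp only: of_nat_0_less_iff card_colors_pos)
qed (rule finite_colorings)

text \<open>
  An update at \<open>v\<close> reads only the colors of the neighbors of \<open>v\<close> and writes only
  the color of \<open>v\<close>, so updates at distinct nonadjacent vertices do not interfere.
\<close>

lemma metropolis_op_commute:
  assumes "(v, w) \<notin> parcs G" "v \<noteq> w"
  shows "P v (P w f) = P w (P v f)"
proof
  fix \<sigma>
  have "(w, v) \<notin> parcs G" using assms G.arcs_symmetric by blast
  then have comm: "recolor G H w d (recolor G H v c \<sigma>) = recolor G H v c (recolor G H w d \<sigma>)" for c d
    using assms by (auto simp: recolor_def fun_upd_twist)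
  have "P v (P w f) \<sigma> = (\<Sum>c\<in>pverts H. \<Sum>d\<in>pverts H.
      f (recolor G H w d (recolor G H v c \<sigma>))) / card (pverts H) / card (pverts H)"
    by (simp add: metropolis_op_def sum_divide_distrib)
  also have "\<dots> = (\<Sum>d\<in>pverts H. \<Sum>c\<in>pverts H.
      f (recolor G H v c (recolor G H w d \<sigma>))) / card (pverts H) / card (pverts H)"
    unfolding comm by (subst sum.swap) simp
  also have "\<dots> = P w (P v f) \<sigma>"
    by (simp add: metropolis_op_def sum_divide_distrib)
  finally show "P v (P w f) \<sigma> = P w (P v f) \<sigma>" .
qed

lemma sum_metropolis_op:
  assumes "v \<in> pverts G"
  shows "(\<Sum>\<sigma>\<in>\<Omega>. P v f \<sigma>) = (\<Sum>\<sigma>\<in>\<Omega>. f \<sigma>)"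
  using assms colors H.pair_finite_verts
  by (intro positive_contraction.sum_preserving metropolis_op_positive_contraction)
    (simp_all add: metropolis_op_def)

lemma set_metropolis_fold_subset:
  assumes "set_pmf \<mu> \<subseteq> \<Omega>" "set vs \<subseteq> pverts G"
  shows "set_pmf (fold (\<lambda>v \<mu>. bind_pmf \<mu> (metropolis G H v)) vs \<mu>) \<subseteq> \<Omega>"
  using assms
proof (induction vs arbitrary: \<mu>)
  case (Cons v vs)
  have "set_pmf (bind_pmf \<mu> (metropolis G H v)) \<subseteq> \<Omega>"
    using Cons.prems recolor_in_colorings[of _ v] by (auto simp: set_metropolis)
  then show ?case using Cons by simp
qed simp

text \<open>
  The scan composes kernels from left to right, while operators act on functions from the left:
  the vertex updated last is the operator applied first.
\<close>

lemma expectation_metropolis_fold: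
  assumes "finite (set_pmf \<mu>)"
  shows "measure_pmf.expectation (fold (\<lambda>v \<mu>. bind_pmf \<mu> (metropolis G H v)) vs \<mu>) f
    = measure_pmf.expectation \<mu> (foldr P vs f)"
  using assms
proof (induction vs arbitrary: \<mu>)
  case (Cons v vs)
  have "measure_pmf.expectation (bind_pmf \<mu> (metropolis G H v)) (foldr P vs f)
      = (\<Sum>\<sigma>\<in>set_pmf \<mu>. pmf \<mu> \<sigma> * P v (foldr P vs f) \<sigma>)"
    using Cons.prems finite_set_metropolis
    by (simp add: pmf_expectation_bind[of "set_pmf \<mu>"] expectation_metropolis)
  also have "\<dots> = measure_pmf.expectation \<mu> (P v (foldr P vs f))"
    using Cons.prems
    by (subst integral_measure_pmf_real[of "set_pmf \<mu>"]) (simp_all add: mult.commute)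
  finally show ?case using Cons by (simp add: finite_set_metropolis)
qed simp

lemma expectation_glauber:
  assumes "pverts G \<noteq> {}"
  shows "measure_pmf.expectation (glauber G H \<sigma>) f
    = (\<Sum>v\<in>pverts G. P v f \<sigma>) / card (pverts G)"
  using assms G.pair_finite_verts finite_set_metropolis
  by (simp add: glauber_def pmf_expectation_bind_pmf_of_set expectation_metropolis
      sum_distrib_left[symmetric] divide_inverse mult.commute)

section \<open>Dirichlet forms of the two dynamics\<close>

lemma dirichlet_form_glauber:
  assumes "\<Omega> \<noteq> {}" and "pverts G \<noteq> {}"
  shows "dirichlet_form \<Omega> (pmf_of_set \<Omega>) (glauber G H) f
    = (\<Sum>v\<in>pverts G. energy \<Omega> (P v) f) / card (pverts G) / card \<Omega>"
proof -
  let ?n = "card (pverts G)"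
  define T where "T f \<sigma> = (\<Sum>v\<in>pverts G. P v f \<sigma>) / ?n" for f \<sigma>
  have "dirichlet_form \<Omega> (pmf_of_set \<Omega>) (glauber G H) f = energy \<Omega> T f / card \<Omega>"
  proof (rule dirichlet_form_uniform)
    show "set_pmf (glauber G H \<sigma>) \<subseteq> \<Omega>" if "\<sigma> \<in> \<Omega>" for \<sigma>
      using that assms G.pair_finite_verts recolor_in_colorings
      by (auto simp: glauber_def set_metropolis)
    show "T h \<sigma> = measure_pmf.expectation (glauber G H \<sigma>) h" for h \<sigma>
      by (simp add: T_def expectation_glauber assms)
    show "(\<Sum>\<sigma>\<in>\<Omega>. T h \<sigma>) = (\<Sum>\<sigma>\<in>\<Omega>. h \<sigma>)" for h
    proof -
      have "(\<Sum>\<sigma>\<in>\<Omega>. T h \<sigma>) = (\<Sum>v\<in>pverts G. \<Sum>\<sigma>\<in>\<Omega>. P v h \<sigma>) / ?n"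
        unfolding T_def sum_divide_distrib[symmetric] by (subst sum.swap) simp
      then show ?thesis using assms G.pair_finite_verts by (simp add: sum_metropolis_op)
    qed
  qed (fact finite_colorings assms)+
  also have "energy \<Omega> T f = (\<Sum>v\<in>pverts G. energy \<Omega> (P v) f) / ?n"
  proof -
    have "ip \<Omega> f (T f) = (\<Sum>v\<in>pverts G. ip \<Omega> f (P v f)) / ?n"
      unfolding ip_def T_def
      by (subst sum.swap) (simp add: sum_divide_distrib sum_distrib_left)
    then show ?thesis using assms G.pair_finite_verts
      by (simp add: energy_def sum_subtractf diff_divide_distrib)
  qed
  finally show ?thesis .
qed

end

lemma dirichlet_form_scan:
  fixes G :: "nat pair_pre_digraph"
  assumes "coloring_dynamics G H" and "colorings G H \<noteq> {}"
  shows "dirichlet_form (colorings G H) (pmf_of_set (colorings G H)) (systematic_scan G H) f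
    = energy (colorings G H) (foldr (metropolis_op G H) (sorted_list_of_set (pverts G))) f
      / card (colorings G H)"
proof -
  interpret coloring_dynamics G H by fact
  interpret G: pair_graph G by (rule graph_G)
  show ?thesis
  proof (rule dirichlet_form_uniform)
    show "set_pmf (systematic_scan G H \<sigma>) \<subseteq> \<Omega>" if "\<sigma> \<in> \<Omega>" for \<sigma>
      unfolding systematic_scan_def using that G.pair_finite_verts
      by (intro set_metropolis_fold_subset) auto
    show "foldr P (sorted_list_of_set (pverts G)) h \<sigma>
        = measure_pmf.expectation (systematic_scan G H \<sigma>) h" for h \<sigma>
      by (simp add: systematic_scan_def expectation_metropolis_fold)
    have "(\<Sum>\<sigma>\<in>\<Omega>. foldr P vs h \<sigma>) = (\<Sum>\<sigma>\<in>\<Omega>. h \<sigma>)" if "set vs \<subseteq> pverts G" for h vs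
      using that by (induction vs) (simp_all add: sum_metropolis_op)
    then show "(\<Sum>\<sigma>\<in>\<Omega>. foldr P (sorted_list_of_set (pverts G)) h \<sigma>) = (\<Sum>\<sigma>\<in>\<Omega>. h \<sigma>)" for h
      using G.pair_finite_verts by simp
  qed (fact finite_colorings assms)+
qed

text \<open>
  The operators that do not commute with the update at \<open>v\<close> belong to neighbors of \<open>v\<close>, and each
  vertex occurs once in the scan, so at most \<open>\<Delta>\<close> of the steps are noncommuting. The bound per vertex
  survives the average over \<open>v\<close> that defines Glauber dynamics.
\<close>

lemma dirichlet_form_glauber_le_scan:
  fixes G :: "nat pair_pre_digraph"
  assumes dyn: "coloring_dynamics G H" and ne: "colorings G H \<noteq> {}" "pverts G \<noteq> {}"
  shows "dirichlet_form (colorings G H) (pmf_of_set (colorings G H)) (glauber G H) f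
    \<le> 2 ^ (max_degree G + 1)
      * dirichlet_form (colorings G H) (pmf_of_set (colorings G H)) (systematic_scan G H) f"
proof -
  interpret coloring_dynamics G H by fact
  interpret G: pair_graph G by (rule graph_G)
  let ?vs = "sorted_list_of_set (pverts G)" and ?n = "card (pverts G)"
  have n: "?n > 0" using ne G.pair_finite_verts by (simp add: card_gt_0_iff)
  have energy: "energy \<Omega> (P v) f \<le> 2 ^ (max_degree G + 1) * energy \<Omega> (foldr P ?vs) f"
    if v: "v \<in> pverts G" for v
  proof -
    have "v \<in> set ?vs" using v G.pair_finite_verts by simp
    then obtain as bs where vs: "?vs = as @ v # bs" by (meson split_list)
    have dist: "distinct ?vs" by simp
    have "length (filter (\<lambda>w. (v, w) \<in> parcs G) bs) = card {w \<in> set bs. (v, w) \<in> parcs G}"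
      using dist unfolding vs by (simp add: distinct_length_filter Int_def conj_commute)
    also have "\<dots> = card (Pair v ` {w \<in> set bs. (v, w) \<in> parcs G})"
      by (simp add: card_image inj_on_def)
    also have "\<dots> \<le> out_degree (with_proj G) v"
      unfolding out_degree_def out_arcs_def
      using G.pair_finite_arcs by (intro card_mono) auto
    also have "\<dots> \<le> max_degree G"
      unfolding max_degree_def using v G.pair_finite_verts by (intro Max_ge) auto
    finally have deg: "length (filter (\<lambda>w. (v, w) \<in> parcs G) bs) \<le> max_degree G" .
    show ?thesis
    proof (rule energy_le_sweep_energy[OF vs _ _ deg])
      show "positive_contraction \<Omega> (P w)" if "w \<in> set ?vs" for w
        using that G.pair_finite_verts by (intro metropolis_op_positive_contraction) simp
      show "P v (P w h) = P w (P v h)" if "w \<in> set bs" "(v, w) \<notin> parcs G" for w h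
        using that dist unfolding vs by (intro metropolis_op_commute) auto
    qed
  qed
  have "(\<Sum>v\<in>pverts G. energy \<Omega> (P v) f)
      \<le> ?n * (2 ^ (max_degree G + 1) * energy \<Omega> (foldr P ?vs) f)"
    using energy by (rule sum_bounded_above)
  then have "(\<Sum>v\<in>pverts G. energy \<Omega> (P v) f) / ?n
      \<le> 2 ^ (max_degree G + 1) * energy \<Omega> (foldr P ?vs) f"
    using n by (simp add: field_simps)
  then show ?thesis
    unfolding dirichlet_form_glauber[OF ne] dirichlet_form_scan[OF dyn ne(1)] times_divide_eq_right
    by (rule divide_right_mono) simp
qed

section \<open>Comparison of the Poincare constants\<close>

lemma dirichlet_form_nonneg: "dirichlet_form \<Omega> \<pi> K f \<ge> 0"
  by (simp add: dirichlet_form_def sum_nonneg)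

lemma variance_on_nonneg: "variance_on \<Omega> \<pi> f \<ge> 0"
  by (simp add: variance_on_def sum_nonneg)

text \<open>
  With at most one color there is at most one coloring. This is where \<open>q \<ge> 2\<close>, which turns a power of
  \<open>2\<close> into a power of \<open>q\<close>, comes from.
\<close>

lemma two_colors_if_not_constant_on_colorings:
  assumes "finite (pverts H)" "\<not> f constant_on colorings G H"
  shows "card (pverts H) \<ge> 2"
proof (rule ccontr)
  assume "\<not> card (pverts H) \<ge> 2"
  then have "card (pverts H) \<le> Suc 0" by simp
  then have unique: "c = d" if "c \<in> pverts H" "d \<in> pverts H" for c d
    using that card_le_Suc0_iff_eq[OF assms(1)] by blast
  have "\<sigma> = \<tau>" if "\<sigma> \<in> colorings G H" "\<tau> \<in> colorings G H" for \<sigma> \<tau>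
  proof (rule PiE_ext)
    show "\<sigma> \<in> pverts G \<rightarrow>\<^sub>E pverts H" "\<tau> \<in> pverts G \<rightarrow>\<^sub>E pverts H"
      using that by (simp_all add: colorings_def)
    then show "\<sigma> v = \<tau> v" if "v \<in> pverts G" for v
      using that by (intro unique) (auto dest: PiE_mem)
  qed
  then show False using assms(2) by (metis constant_on_def)
qed

text \<open>
  Both constants may be \<open>\<infinity>\<close>. Dividing by the positive real \<open>c\<close> moves it out of the way of the
  infimum on the right.
\<close>

lemma poincare_constant_le_mult:
  assumes c: "c > 0"
    and form: "\<And>f. \<not> f constant_on \<Omega> \<Longrightarrow> dirichlet_form \<Omega> \<pi> K f \<le> c * dirichlet_form \<Omega> \<pi> L f"
  shows "poincare_constant \<Omega> \<pi> K \<le> ereal c * poincare_constant \<Omega> \<pi> L"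
proof -
  have "poincare_constant \<Omega> \<pi> K / ereal c \<le> poincare_constant \<Omega> \<pi> L"
    unfolding poincare_constant_def[of \<Omega> \<pi> L]
  proof (rule INF_greatest)
    fix f :: "'a \<Rightarrow> real" assume f: "f \<in> {f. \<not> f constant_on \<Omega>}"
    have "poincare_constant \<Omega> \<pi> K \<le> ereal (dirichlet_form \<Omega> \<pi> K f / variance_on \<Omega> \<pi> f)"
      unfolding poincare_constant_def using f by (rule INF_lower)
    also have "\<dots> \<le> ereal (c * dirichlet_form \<Omega> \<pi> L f / variance_on \<Omega> \<pi> f)"
      using form[of f] f variance_on_nonneg[of \<Omega> \<pi> f] by (simp add: divide_right_mono)
    finally show "poincare_constant \<Omega> \<pi> K / ereal c
        \<le> ereal (dirichlet_form \<Omega> \<pi> L f / variance_on \<Omega> \<pi> f)"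
      using c by (simp add: ereal_divide_le_pos)
  qed
  then show ?thesis using c by (simp add: ereal_divide_le_pos)
qed

theorem theorem30:
  fixes G :: "nat pair_pre_digraph" and H :: "'c pair_pre_digraph" and n \<Delta> q :: nat
  assumes "pair_graph G" and "pverts G = {1..n}" and "n > 3" and "max_degree G = \<Delta>"
    and "pair_pseudo_graph H" and "pverts H \<noteq> {}" and "card (pverts H) = q"
  shows "lambda_glauber G H \<le> ereal (4 * real q ^ (\<Delta> + 1)) * lambda_scan G H"
  unfolding lambda_glauber_def lambda_scan_def
proof (rule poincare_constant_le_mult)
  have dyn: "coloring_dynamics G H" using assms by (simp add: coloring_dynamics_def)
  have fin: "finite (pverts H)" using pair_pseudo_graph.axioms(1)[OF assms(5)]
    by (rule pair_fin_digraph.pair_finite_verts)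
  have "q > 0" using assms(6,7) fin card_gt_0_iff[of "pverts H"] by simp
  then show "4 * real q ^ (\<Delta> + 1) > 0" by simp
  let ?D = "dirichlet_form (colorings G H) (pmf_of_set (colorings G H))"
  fix f :: "(nat \<Rightarrow> 'c) \<Rightarrow> real" assume f: "\<not> f constant_on colorings G H"
  then have q: "q \<ge> 2" using two_colors_if_not_constant_on_colorings[OF fin f] assms by simp
  have "?D (glauber G H) f \<le> 2 ^ (\<Delta> + 1) * ?D (systematic_scan G H) f"
    using dirichlet_form_glauber_le_scan[OF dyn, of f] f assms by (auto simp: constant_on_def)
  also have "\<dots> \<le> (4 * real q ^ (\<Delta> + 1)) * ?D (systematic_scan G H) f"
  proof (rule mult_right_mono[OF _ dirichlet_form_nonneg])
    have "(2 :: real) ^ (\<Delta> + 1) \<le> real q ^ (\<Delta> + 1)" using q by (intro power_mono) auto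
    also have "\<dots> \<le> 4 * real q ^ (\<Delta> + 1)" by simp
    finally show "(2 :: real) ^ (\<Delta> + 1) \<le> 4 * real q ^ (\<Delta> + 1)" .
  qed
  finally show "?D (glauber G H) f \<le> (4 * real q ^ (\<Delta> + 1)) * ?D (systematic_scan G H) f" .
qed

end
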